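(* Suppose $\{P_n^{(\alpha,\beta)}(x)\}_{n=0}^\infty$ is a sequence of Jacobi polynomials with $\alpha > -1$, $\beta > -1$. Assume that $P_n^{(\alpha,\beta)}(x)$ and $P_{n+1}^{(\alpha+1,\beta+1)}(x)$ have no common zeros. For $n \ge 4$, let $\{x_k\}_{k=1}^n$ denote the zeros of $P_n^{(\alpha,\beta)}(x)$ with $-1 < x_1 < x_2 < \dots < x_n < 1$. Then at least $n-3$ of the $n-1$ intervals $(x_k,x_{k+1})$, $k\in\{1,\dots,n-1\}$, with endpoints at successive zeros of $P_n^{(\alpha,\beta)}(x)$ contain a simple zero of $P_{n+1}^{(\alpha+1,\beta+1)}(x)$, $n \ge 4$. The location of the $4$ remaining zeros of $P_{n+1}^{(\alpha+1,\beta+1)}(x)$ is not possible to specify in general, as different possibilities can occur depending on the values of $n$, $\alpha$ and $\beta$.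
   Context: For $\alpha,\beta>-1$, $\{P_n^{(\alpha,\beta)}(x)\}_{n=0}^\infty$ denotes the sequence of Jacobi polynomials: $P_n^{(\alpha,\beta)}$ has degree $n$ and the sequence is orthogonal on $(-1,1)$ with respect to the measure $(1-x)^\alpha(1+x)^\beta\,dx$ (the polynomials are unique up to normalization, which does not affect zeros). All $n$ zeros of $P_n^{(\alpha,\beta)}$ are real, simple and lie in $(-1,1)$; likewise $P_{n+1}^{(\alpha+1,\beta+1)}$ has $n+1$ real, simple zeros in $(-1,1)$. The "4 remaining zeros" are those of the $n+1$ zeros of $P_{n+1}^{(\alpha+1,\beta+1)}$ left over after taking one zero in each of $n-3$ such intervals. *)

theory Defs
  imports "HOL-Analysis.Analysis" "HOL-Computational_Algebra.Polynomial"
begin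

text \<open>The normalization is left free. For \<open>\<alpha>, \<beta> > -1\<close> all the integrands below are integrable.
  The condition \<open>P n \<noteq> 0\<close> matters only for \<open>n = 0\<close>, since \<open>degree 0 = 0\<close>.\<close>

definition jacobi_sequence :: "real \<Rightarrow> real \<Rightarrow> (nat \<Rightarrow> real poly) \<Rightarrow> bool" where
  "jacobi_sequence \<alpha> \<beta> P \<longleftrightarrow>
     (\<forall>n. P n \<noteq> 0 \<and> degree (P n) = n) \<and>
     (\<forall>m n. m \<noteq> n \<longrightarrow>
        set_lebesgue_integral lborel {-1<..<1}
          (\<lambda>t. poly (P m) t * poly (P n) t * ((1 - t) powr \<alpha> * (1 + t) powr \<beta>)) = 0)"

definition jacobi_setting ::
  "nat \<Rightarrow> real \<Rightarrow> real \<Rightarrow> (nat \<Rightarrow> real poly) \<Rightarrow> (nat \<Rightarrow> real poly) \<Rightarrow> (nat \<Rightarrow> real) \<Rightarrow> bool" where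
  "jacobi_setting n \<alpha> \<beta> P Q x \<longleftrightarrow>
     n \<ge> 4 \<and> \<alpha> > -1 \<and> \<beta> > -1 \<and>
     jacobi_sequence \<alpha> \<beta> P \<and> jacobi_sequence (\<alpha> + 1) (\<beta> + 1) Q \<and>
     (\<nexists>t. poly (P n) t = 0 \<and> poly (Q (n + 1)) t = 0) \<and>
     strict_mono_on {1..n} x \<and> x ` {1..n} = {t. poly (P n) t = 0} \<and>
     -1 < x 1 \<and> x n < 1"

definition simple_zero :: "real poly \<Rightarrow> real \<Rightarrow> bool" where
  "simple_zero p t \<longleftrightarrow> p \<noteq> 0 \<and> order t p = 1"

text \<open>The set \<open>R\<close> consists of the zeros of \<open>q\<close> left over after taking one simple zero \<open>y k\<close>
  in each of \<open>n - 3\<close> of the intervals \<open>(x k, x (k + 1))\<close>. In general \<open>R\<close> depends on these choices.\<close>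

definition remaining_zeros :: "nat \<Rightarrow> real poly \<Rightarrow> (nat \<Rightarrow> real) \<Rightarrow> real set \<Rightarrow> bool" where
  "remaining_zeros n q x R \<longleftrightarrow>
     (\<exists>K y. K \<subseteq> {1..n - 1} \<and> card K = n - 3 \<and>
        (\<forall>k\<in>K. y k \<in> {x k<..<x (k + 1)} \<and> simple_zero q (y k)) \<and>
        R = {t. poly q t = 0} - y ` K)"

text \<open>How many points of \<open>R\<close> lie to the left of all \<open>x k\<close>, between successive \<open>x k\<close>, and to the
  right of all \<open>x k\<close>. Unlike interval indices, this can be compared for different \<open>n\<close>; and on the
  sets \<open>R\<close> of remaining zeros it does not depend on the choices made, since those remove
  exactly \<open>n - 3\<close> zeros from the middle part.\<close>

definition location :: "nat \<Rightarrow> (nat \<Rightarrow> real) \<Rightarrow> real set \<Rightarrow> nat \<times> nat \<times> nat" where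
  "location n x R =
     (card (R \<inter> {-1<..<x 1}),
      card (R \<inter> (\<Union>k\<in>{1..n - 1}. {x k<..<x (k + 1)})),
      card (R \<inter> {x n<..<1}))"

definition locations :: "nat \<Rightarrow> real \<Rightarrow> real \<Rightarrow> (nat \<times> nat \<times> nat) set" where
  "locations n \<alpha> \<beta> =
     {location n x R | P Q x R. jacobi_setting n \<alpha> \<beta> P Q x \<and> remaining_zeros n (Q (n + 1)) x R}"

text \<open>Nonemptiness says that both parameter triples are admissible.\<close>

definition different_locations ::
  "nat \<times> real \<times> real \<Rightarrow> nat \<times> real \<times> real \<Rightarrow> bool" where
  "different_locations = (\<lambda>(n, \<alpha>, \<beta>) (n', \<alpha>', \<beta>').
     locations n \<alpha> \<beta> \<noteq> {} \<and> locations n' \<alpha>' \<beta>' \<noteq> {} \<and>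
     locations n \<alpha> \<beta> \<inter> locations n' \<alpha>' \<beta>' = {})"

end

theory Submission
  imports Defs
begin

text \<open>
Write \<open>w\<close> for the weight \<open>(1 - t)\<^sup>\<alpha> (1 + t)\<^sup>\<beta>\<close> and put \<open>f = (1 - t\<^sup>2) Q\<close>, where \<open>Q\<close> is the Jacobi polynomial of
degree \<open>n + 1\<close> with both parameters raised by one. The weight of \<open>Q\<close> is \<open>(1 - t\<^sup>2) w\<close>, so \<open>f\<close> is
orthogonal with respect to \<open>w\<close> to all polynomials of degree at most \<open>n\<close>. The Gauss quadrature formula
for \<open>w\<close> with nodes at the zeros \<open>x\<^sub>1 < \<dots> < x\<^sub>n\<close> of \<open>P\<^sub>n\<close> has positive coefficients and is exact up to
degree \<open>2n - 1\<close>. Since \<open>f\<close> has degree \<open>n + 3\<close>, it follows that the values of \<open>f\<close> at the nodes satisfy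
\<open>\<Sum> \<lambda>\<^sub>k f(x\<^sub>k) h(x\<^sub>k) = 0\<close> for every \<open>h\<close> of degree at most \<open>n - 4\<close>. These values are nonzero, as there are no common
zeros. If they changed sign in at most \<open>n - 4\<close> of the gaps, a suitable \<open>h\<close> with one zero in each of
these gaps would make all terms of the sum positive. So \<open>f\<close>, and with it \<open>Q\<close>, changes sign in at least
\<open>n - 3\<close> gaps and has a zero there. This is \<open>sign_changes_at_zeros\<close>, applied in
\<open>jacobi_setting_sign_changes\<close>. All \<open>n + 1\<close> zeros of \<open>Q\<close> are simple and lie in \<open>(-1, 1)\<close> by the classical
argument in \<open>zeros_of_annihilates\<close>, so \<open>4\<close> of them remain.

That the remaining zeros have no fixed location is shown by examples. The number of remaining
zeros to the right of \<open>x\<^sub>n\<close> does not depend on any choice (\<open>locations_right_component\<close>). It is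
positive for \<open>(n, \<alpha>, \<beta>) = (4, 1, 1)\<close> and zero for \<open>(5, 1, 1)\<close>, \<open>(4, 0, 1)\<close> and \<open>(4, 1, 2)\<close>, and the
latter arise from the former by changing one parameter. For natural \<open>\<alpha>\<close> and \<open>\<beta>\<close> the Jacobi polynomials
are explicit and everything about them is verified by rational arithmetic. Existence of
an admissible setting for these parameters (\<open>locations_nonempty\<close>) rests on the Gram--Schmidt
process and on the coprimality of the two polynomials.
\<close>

section \<open>Positive functionals and orthogonal polynomials\<close>

text \<open>The only properties of integration against a Jacobi weight that the theory of zeros needs.
Positivity is required of polynomials that are nonnegative on \<open>(-1, 1)\<close>, so it is here that the
interval of orthogonality enters.\<close>
locale positive_functional =
  fixes L :: "real poly \<Rightarrow> real"
  assumes add: "L (p + q) = L p + L q"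
    and smult: "L (smult c p) = c * L p"
    and pos: "p \<noteq> 0 \<Longrightarrow> (\<And>t. -1 < t \<Longrightarrow> t < 1 \<Longrightarrow> 0 \<le> poly p t) \<Longrightarrow> 0 < L p"
begin

definition annihilates :: "real poly \<Rightarrow> nat \<Rightarrow> bool" where
  "annihilates p n \<longleftrightarrow> (\<forall>r. degree r < n \<longrightarrow> L (p * r) = 0)"

lemma zero [simp]: "L 0 = 0"
  using smult[of 0 0] by simp

lemma diff: "L (p - q) = L p - L q"
  using add[of "p - q" q] by simp

lemma sum: "L (\<Sum>i\<in>I. f i) = (\<Sum>i\<in>I. L (f i))"
  by (induction I rule: infinite_finite_induct) (simp_all add: add)

lemma annihilatesD: "annihilates p n \<Longrightarrow> degree r < n \<Longrightarrow> L (p * r) = 0"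
  by (simp add: annihilates_def)

text \<open>Orthogonality to one polynomial of each degree below \<open>n\<close> suffices, since leading terms can be
subtracted one after the other. With \<open>B\<close> the orthogonal sequence itself this turns pairwise
orthogonality into orthogonality to all lower degrees; with \<open>B\<close> the monomials it reduces
orthogonality of a concrete polynomial to finitely many moments.\<close>
lemma annihilates_graded_basis:
  assumes "\<And>k. k < n \<Longrightarrow> B k \<noteq> 0 \<and> degree (B k) = k"
    and "\<And>k. k < n \<Longrightarrow> L (q * B k) = 0"
  shows "annihilates q n"
  using assms
proof (induction n)
  case 0
  then show ?case by (simp add: annihilates_def)
next
  case (Suc n)
  then have IH: "annihilates q n" by simp
  have Bn: "B n \<noteq> 0" "degree (B n) = n" "L (q * B n) = 0" using Suc.prems by auto
  show ?case
    unfolding annihilates_def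
  proof (intro allI impI)
    fix r :: "real poly" assume r: "degree r < Suc n"
    define c where "c = coeff r n / lead_coeff (B n)"
    define r' where "r' = r - smult c (B n)"
    have "degree r' \<le> n" unfolding r'_def
      using r Bn by (intro degree_diff_le) (auto intro: order.trans[OF degree_smult_le])
    moreover have "coeff r' n = 0"
      using Bn(1,2) leading_coeff_0_iff[of "B n"] by (simp add: r'_def c_def)
    ultimately have "r' = 0 \<or> degree r' < n" by (rule eq_zero_or_degree_less)
    then have "L (q * r') = 0" using annihilatesD[OF IH] by auto
    moreover have "q * r = q * r' + smult c (q * B n)"
      by (simp add: r'_def algebra_simps)
    ultimately show "L (q * r) = 0" using Bn by (simp add: add smult)
  qed
qed

lemma square_pos: "p \<noteq> 0 \<Longrightarrow> 0 < L (p * p)"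
  by (rule pos) auto

text \<open>Subtracting a multiple that cancels the leading terms leaves a polynomial of lower degree that is
orthogonal to itself, hence zero. This is why the arbitrary normalization of a Jacobi sequence is harmless.\<close>
lemma annihilates_unique:
  assumes p: "p \<noteq> 0" "annihilates p (degree p)"
    and q: "q \<noteq> 0" "annihilates q (degree q)" and "degree p = degree q"
  obtains c where "c \<noteq> 0" "p = smult c q"
proof -
  define c where "c = lead_coeff p / lead_coeff q"
  define d where "d = p - smult c q"
  have "degree d \<le> degree q" unfolding d_def
    using assms by (intro degree_diff_le) (auto intro: order.trans[OF degree_smult_le])
  moreover have "coeff d (degree q) = 0"
    using assms by (simp add: d_def c_def)
  ultimately have d: "d = 0 \<or> degree d < degree q" by (rule eq_zero_or_degree_less)
  have "d = 0"
  proof (rule ccontr)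
    assume "d \<noteq> 0"
    with d have "degree d < degree q" by simp
    then have "L (p * d) = 0" "L (q * d) = 0"
      using p q assms(5) by (simp_all add: annihilatesD)
    moreover have "d * d = p * d - smult c (q * d)"
      by (subst (1) d_def) (simp add: left_diff_distrib)
    ultimately have "L (d * d) = 0" by (simp add: diff smult)
    with square_pos[OF \<open>d \<noteq> 0\<close>] show False by simp
  qed
  moreover have "c \<noteq> 0" using p q by (simp add: c_def)
  ultimately show ?thesis using that[of c] by (simp add: d_def)
qed

text \<open>The Gram--Schmidt process: correct the monomial of degree \<open>n\<close> by its projections to orthogonal
polynomials of lower degree.\<close>
lemma ex_annihilates:
  "\<exists>p. p \<noteq> 0 \<and> degree p = n \<and> annihilates p n"
proof (induction n rule: less_induct)
  case (less n)
  then obtain B where B: "\<And>k. k < n \<Longrightarrow> B k \<noteq> 0 \<and> degree (B k) = k \<and> annihilates (B k) k"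
    by metis
  have B0: "L (B j * B k) = 0" if "j < n" "k < n" "j \<noteq> k" for j k
  proof (cases "j < k")
    case True
    then have "L (B k * B j) = 0" using B that by (intro annihilatesD[of "B k" k]) auto
    then show ?thesis by (simp add: mult.commute)
  next
    case False
    then show ?thesis using B that by (intro annihilatesD[of "B j" j]) auto
  qed
  define c where "c k = L (monom 1 n * B k) / L (B k * B k)" for k
  define s where "s = (\<Sum>k<n. smult (c k) (B k))"
  define p where "p = monom 1 n - s"
  have cs: "coeff s i = 0" if "i \<ge> n" for i
    unfolding s_def coeff_sum using B that by (intro sum.neutral) (auto intro!: coeff_eq_0)
  have cn: "coeff p n = 1" by (simp add: p_def cs)
  have "degree p \<le> n" by (rule degree_le) (auto simp: p_def cs)
  moreover have "degree p \<ge> n" using cn by (intro le_degree) simp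
  moreover have "p \<noteq> 0" using cn by auto
  moreover have "annihilates p n"
  proof (rule annihilates_graded_basis)
    fix k assume k: "k < n"
    have "L (s * B k) = (\<Sum>j<n. c j * L (B j * B k))"
      by (simp add: s_def sum_distrib_right sum smult)
    also have "\<dots> = (\<Sum>j<n. if j = k then c k * L (B k * B k) else 0)"
      using k B0 by (intro sum.cong) auto
    also have "\<dots> = L (monom 1 n * B k)"
      using k B square_pos[of "B k"] by (auto simp: c_def)
    finally show "L (p * B k) = 0" by (simp add: p_def left_diff_distrib diff)
  qed (use B in auto)
  ultimately show ?case by (intro exI[of _ p]) auto
qed

end

section \<open>Zeros of orthogonal polynomials and Gauss quadrature\<close>

lemma nonzero_poly_const_sign:
  fixes p :: "real poly"
  assumes "\<And>t. -1 < t \<Longrightarrow> t < 1 \<Longrightarrow> poly p t \<noteq> 0" "-1 < s" "s < 1" "-1 < t" "t < 1"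
  shows "0 < poly p s * poly p t"
proof (rule ccontr)
  assume "\<not> 0 < poly p s * poly p t"
  moreover have "poly p s * poly p t \<noteq> 0"
    using assms(1)[OF assms(2,3)] assms(1)[OF assms(4,5)] by simp
  ultimately have neg: "poly p s * poly p t < 0" by linarith
  have "s \<noteq> t" using neg zero_le_square[of "poly p s"] by force
  then consider "s < t" | "t < s" by linarith
  then show False
  proof cases
    case 1
    from poly_IVT[OF this neg] obtain z where "s < z" "z < t" "poly p z = 0" by auto
    then show False using assms(1)[of z] assms(2-5) by linarith
  next
    case 2
    have "poly p t * poly p s < 0" using neg by (simp add: mult.commute)
    from poly_IVT[OF 2 this] obtain z where "t < z" "z < s" "poly p z = 0" by auto
    then show False using assms(1)[of z] assms(2-5) by linarith
  qed
qed

text \<open>The zeros of odd order in the interval can serve as \<open>S\<close>. Adding or deleting \<open>a\<close> in \<open>S\<close> when a factor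
\<open>t - a\<close> is split off avoids talking about parities of orders.\<close>
lemma sign_correcting_factor:
  fixes p :: "real poly"
  assumes "p \<noteq> 0"
  shows "\<exists>S \<sigma>. finite S \<and> S \<subseteq> {t \<in> {-1<..<1}. poly p t = 0} \<and> \<sigma> \<noteq> 0 \<and>
           (\<forall>t\<in>{-1<..<1}. 0 \<le> poly p t * (\<sigma> * (\<Prod>z\<in>S. t - z)))"
  using assms
proof (induction "degree p" arbitrary: p rule: less_induct)
  case less
  show ?case
  proof (cases "\<exists>a\<in>{-1<..<1}. poly p a = 0")
    case False
    have "0 < poly p 0 * poly p t" if "-1 < t" "t < 1" for t
      using False that by (intro nonzero_poly_const_sign) auto
    then have "\<forall>t\<in>{-1<..<1}. 0 \<le> poly p t * (poly p 0 * (\<Prod>z\<in>{}. t - z))"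
      by (auto simp: mult.commute intro: less_imp_le)
    moreover have "poly p 0 \<noteq> 0" using False by auto
    ultimately show ?thesis by (intro exI[of _ "{}"] exI[of _ "poly p 0"]) auto
  next
    case True
    then obtain a where a: "a \<in> {-1<..<1}" "poly p a = 0" by auto
    then obtain q where q: "p = [:-a, 1:] * q" by (auto simp: poly_eq_0_iff_dvd)
    with less.prems have "q \<noteq> 0" by auto
    then have "degree q < degree p" unfolding q by (subst degree_mult_eq) auto
    from less.hyps[OF this \<open>q \<noteq> 0\<close>] obtain S \<sigma> where
      S: "finite S" "S \<subseteq> {t \<in> {-1<..<1}. poly q t = 0}" "\<sigma> \<noteq> 0"
        "\<And>t. t \<in> {-1<..<1} \<Longrightarrow> 0 \<le> poly q t * (\<sigma> * (\<Prod>z\<in>S. t - z))" by blast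
    have sub: "S \<subseteq> {t \<in> {-1<..<1}. poly p t = 0}" using S by (auto simp: q)
    show ?thesis
    proof (cases "a \<in> S")
      case True
      have "0 \<le> poly p t * (\<sigma> * (\<Prod>z\<in>S - {a}. t - z))" if "t \<in> {-1<..<1}" for t
        using S(4)[OF that] prod.remove[OF S(1) True, of "\<lambda>z. t - z"]
        by (simp add: q algebra_simps)
      then show ?thesis using S sub by (intro exI[of _ "S - {a}"] exI[of _ \<sigma>]) auto
    next
      case False
      have "0 \<le> poly p t * (\<sigma> * (\<Prod>z\<in>insert a S. t - z))" if "t \<in> {-1<..<1}" for t
      proof -
        have "poly p t * (\<sigma> * (\<Prod>z\<in>insert a S. t - z))
            = (t - a)\<^sup>2 * (poly q t * (\<sigma> * (\<Prod>z\<in>S. t - z)))"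
          using False S by (simp add: q power2_eq_square algebra_simps)
        also have "\<dots> \<ge> 0" using S(4)[OF that] by (rule mult_nonneg_nonneg[OF zero_le_power2])
        finally show ?thesis .
      qed
      then show ?thesis using S sub a by (intro exI[of _ "insert a S"] exI[of _ \<sigma>]) auto
    qed
  qed
qed

lemma degree_prod_linear: "degree (\<Prod>z\<in>S. [:- f z, 1:] :: real poly) = card S"
  by (subst degree_prod_sum_eq) auto

text \<open>A double zero would leave a cofactor of degree \<open>degree p - 2\<close>, too small for the remaining zeros.\<close>
lemma order_eq_1_if_card_roots_eq_degree:
  fixes p :: "real poly"
  assumes "p \<noteq> 0" "card {t. poly p t = 0} = degree p" "poly p t = 0"
  shows "order t p = 1"
proof (rule antisym)
  show "1 \<le> order t p" using assms order_root[of p t] by (simp add: Suc_le_eq)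
  show "order t p \<le> 1"
  proof (rule ccontr)
    assume "\<not> order t p \<le> 1"
    then have "[:-t, 1:] ^ 2 dvd p"
      using order_1[of t p] dvd_trans[OF le_imp_power_dvd[of 2 "order t p"]] by simp
    then obtain q where q: "p = [:-t, 1:] ^ 2 * q" by (elim dvdE)
    with assms have "q \<noteq> 0" by auto
    then have deg: "degree p = 2 + degree q"
      unfolding q by (subst degree_mult_eq) (auto simp: degree_power_eq)
    have "{s. poly p s = 0} \<subseteq> insert t {s. poly q s = 0}" by (auto simp: q)
    then have "card {s. poly p s = 0} \<le> card (insert t {s. poly q s = 0})"
      using poly_roots_finite[OF \<open>q \<noteq> 0\<close>] by (intro card_mono) auto
    also have "\<dots> \<le> 1 + card {s. poly q s = 0}"
      using poly_roots_finite[OF \<open>q \<noteq> 0\<close>] by (simp add: card_insert_if)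
    also have "\<dots> \<le> 1 + degree q" using card_poly_roots_bound[OF \<open>q \<noteq> 0\<close>] by simp
    finally show False using assms deg by simp
  qed
qed

context positive_functional
begin

text \<open>If \<open>p\<close> had fewer than \<open>degree p\<close> zeros of odd order in the interval, then \<open>p\<close> would be orthogonal to
the factor that makes it nonnegative, against positivity.\<close>
lemma zeros_of_annihilates:
  assumes p: "p \<noteq> 0" "annihilates p (degree p)"
  shows "{t. poly p t = 0} \<subseteq> {-1<..<1}" "card {t. poly p t = 0} = degree p"
proof -
  obtain S \<sigma> where S: "finite S" "S \<subseteq> {t \<in> {-1<..<1}. poly p t = 0}" "\<sigma> \<noteq> 0"
      "\<And>t. t \<in> {-1<..<1} \<Longrightarrow> 0 \<le> poly p t * (\<sigma> * (\<Prod>z\<in>S. t - z))"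
    using sign_correcting_factor[OF p(1)] by blast
  define h where "h = smult \<sigma> (\<Prod>z\<in>S. [:-z, 1:])"
  have "h \<noteq> 0" using S by (auto simp: h_def)
  have "0 < L (p * h)"
  proof (rule pos)
    show "0 \<le> poly (p * h) t" if "-1 < t" "t < 1" for t
      using S(4)[of t] that by (simp add: h_def poly_prod mult.left_commute)
  qed (use p \<open>h \<noteq> 0\<close> in simp)
  moreover have "degree h = card S" using S by (simp add: h_def degree_prod_linear)
  ultimately have ge: "degree p \<le> card S" using annihilatesD[OF p(2), of h] by force
  have fin: "finite {t. poly p t = 0}" by (rule poly_roots_finite[OF p(1)])
  have le: "card {t. poly p t = 0} \<le> degree p" by (rule card_poly_roots_bound[OF p(1)])
  have "S \<subseteq> {t. poly p t = 0}" using S by auto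
  moreover from this have "card S \<le> card {t. poly p t = 0}" using fin by (intro card_mono)
  ultimately have "S = {t. poly p t = 0}" using ge le fin by (intro card_subset_eq) auto
  then show "{t. poly p t = 0} \<subseteq> {-1<..<1}" "card {t. poly p t = 0} = degree p"
    using S ge le by auto
qed

text \<open>The weights are the values of \<open>L\<close> at the Lagrange polynomials. Dividing \<open>g\<close> by \<open>p\<close> gives exactness up to
degree \<open>2 * degree p - 1\<close>, because \<open>p\<close> is orthogonal to the quotient, whose
degree is below \<open>degree p\<close>. Exactness for the square of a Lagrange polynomial gives positivity.\<close>
lemma gauss_quadrature:
  assumes p: "p \<noteq> 0" "annihilates p (degree p)"
  defines "Z \<equiv> {t. poly p t = 0}"
  obtains wt where "\<And>z. z \<in> Z \<Longrightarrow> 0 < wt z"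
    "\<And>g. degree g < 2 * degree p \<Longrightarrow> L g = (\<Sum>z\<in>Z. wt z * poly g z)"
proof -
  have Z: "finite Z" "card Z = degree p"
    using zeros_of_annihilates[OF p] poly_roots_finite[OF p(1)] by (auto simp: Z_def)
  define l where "l z = (\<Prod>w\<in>Z - {z}. smult (1 / (z - w)) [:- w, 1:])" for z
  have deg_l: "degree (l z) < degree p" if "z \<in> Z" for z
  proof -
    have "degree (l z) \<le> (\<Sum>w\<in>Z - {z}. 1)"
      unfolding l_def using Z
      by (intro order.trans[OF degree_prod_sum_le] sum_mono) (auto simp: degree_pCons_eq_if)
    also have "\<dots> = card Z - 1" using that Z by simp
    also have "\<dots> < card Z" using that Z card_gt_0_iff[of Z] by force
    finally show ?thesis using Z by simp
  qed
  have eval_l: "poly (l z) w = (if w = z then 1 else 0)" if "z \<in> Z" "w \<in> Z" for z w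
  proof (cases "w = z")
    case True
    then show ?thesis unfolding l_def poly_prod
      by (simp add: right_diff_distrib flip: diff_divide_distrib)
  next
    case False
    then have "(\<Prod>v\<in>Z - {z}. poly (smult (1 / (z - v)) [:- v, 1:]) w) = 0"
      using that Z by (intro prod_zero) auto
    then show ?thesis using False by (simp add: l_def poly_prod)
  qed
  define wt where "wt z = L (l z)" for z
  have quad: "L g = (\<Sum>z\<in>Z. wt z * poly g z)" if g: "degree g < 2 * degree p" for g
  proof -
    have dp: "degree p > 0" using g by simp
    define s r where "s = g div p" and "r = (\<Sum>z\<in>Z. smult (poly g z) (l z))"
    have "degree (g mod p) < degree p"
      using dp degree_mod_less[OF p(1), of g] by auto
    moreover have "degree r < degree p"
      unfolding r_def using dp deg_l
      by (intro degree_sum_less) (auto intro: le_less_trans[OF degree_smult_le])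
    ultimately have dd: "degree (g mod p - r) < degree p" by (rule degree_diff_less)
    have "poly (g mod p - r) z = 0" if "z \<in> Z" for z
    proof -
      have "poly g z = poly (g div p * p + g mod p) z" by simp
      also have "\<dots> = poly (g mod p) z" using that unfolding poly_add poly_mult by (simp add: Z_def)
      finally have "poly g z = poly (g mod p) z" .
      moreover have "poly r z = (\<Sum>w\<in>Z. if w = z then poly g z else 0)"
        unfolding r_def poly_sum using that by (intro sum.cong) (auto simp: eval_l)
      ultimately show ?thesis using that Z by simp
    qed
    then have "Z \<subseteq> {t. poly (g mod p - r) t = 0}" by auto
    then have "g mod p - r = 0"
      using dd Z card_poly_roots_bound[of "g mod p - r"]
        card_mono[OF poly_roots_finite[of "g mod p - r"], of Z] by linarith
    then have gs: "g = p * s + r" using mult_div_mod_eq[of p g] by (simp add: s_def)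
    have "s = 0 \<or> degree s < degree p"
    proof (rule disjCI)
      assume "\<not> degree s < degree p"
      moreover have "degree (p * s) < 2 * degree p"
        using g \<open>degree r < degree p\<close> gs degree_diff_less[of g "2 * degree p" r] by simp
      ultimately show "s = 0" using degree_mult_eq[OF p(1), of s] by linarith
    qed
    then have "L (p * s) = 0" using annihilatesD[OF p(2)] by auto
    moreover have "L r = (\<Sum>z\<in>Z. wt z * poly g z)"
      by (simp add: r_def sum smult wt_def mult.commute)
    ultimately show ?thesis using gs add[of "p * s" r] by simp
  qed
  have "0 < wt z" if z: "z \<in> Z" for z
  proof -
    have "l z \<noteq> 0" using eval_l[OF z z] by auto
    have "degree (l z * l z) < 2 * degree p"
      using deg_l[OF z] degree_mult_le[of "l z" "l z"] by linarith
    then have "L (l z * l z) = (\<Sum>w\<in>Z. wt w * poly (l z * l z) w)" by (rule quad)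
    also have "\<dots> = (\<Sum>w\<in>Z. if w = z then wt z else 0)"
      using z by (intro sum.cong) (auto simp: eval_l)
    also have "\<dots> = wt z" using z Z by simp
    finally show ?thesis using square_pos[OF \<open>l z \<noteq> 0\<close>] by simp
  qed
  then show ?thesis using that quad by blast
qed

text \<open>The heart of the argument. If \<open>f\<close> changed sign in fewer than \<open>j\<close> gaps between nodes, then multiplying it
by linear factors with one zero in each of these gaps would give a polynomial \<open>f * h\<close> whose values
at all nodes have the same sign. Its degree is still in the range where quadrature with
positive weights is exact, so \<open>L (f * h) \<noteq> 0\<close>, although \<open>f\<close> is orthogonal to \<open>h\<close>.\<close>
lemma sign_changes_at_zeros:
  fixes x :: "nat \<Rightarrow> real"
  assumes p: "p \<noteq> 0" "annihilates p (degree p)" "degree p = n" "1 \<le> n"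
    and x: "strict_mono_on {1..n} x" "x ` {1..n} = {t. poly p t = 0}"
    and f: "annihilates f j" "degree f + j \<le> 2 * n" "\<And>t. poly p t = 0 \<Longrightarrow> poly f t \<noteq> 0"
  shows "j \<le> card {k \<in> {1..n - 1}. poly f (x k) * poly f (x (k + 1)) < 0}" (is "_ \<le> card ?T")
proof (rule ccontr)
  assume "\<not> j \<le> card ?T"
  then have less: "card ?T < j" by simp
  define m where "m k = (x k + x (k + 1)) / 2" for k
  define h where "h = (\<Prod>k\<in>?T. [:- m k, 1:])"
  have deg: "degree h = card ?T" by (simp add: h_def degree_prod_linear)
  then have L0: "L (f * h) = 0" using f less by (simp add: annihilatesD)
  have mono: "x i < x k" if "i \<in> {1..n}" "k \<in> {1..n}" "i < k" for i k
    using x(1) that by (auto simp: strict_mono_on_def)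
  have le: "x i \<le> x k" if "i \<in> {1..n}" "k \<in> {1..n}" "i \<le> k" for i k
    using mono[of i k] that by (cases "i = k") auto
  have fx: "poly f (x k) \<noteq> 0" if "k \<in> {1..n}" for k
    using x(2) that f(3) by blast
  \<comment> \<open>Between neighbouring nodes \<open>h\<close> changes sign precisely when \<open>f\<close> does.\<close>
  have step: "0 < poly (f * h) (x k) * poly (f * h) (x (k + 1))" if k: "k \<in> {1..n - 1}" for k
  proof -
    have k': "k \<in> {1..n}" "k + 1 \<in> {1..n}" using k by auto
    have pos: "0 < (x k - m i) * (x (k + 1) - m i)" if "i \<in> {1..n - 1}" "i \<noteq> k" for i
    proof -
      have i: "i \<in> {1..n}" "i + 1 \<in> {1..n}" using that by auto
      have im: "x i < m i" "m i < x (i + 1)" using mono[of i "i + 1"] i by (auto simp: m_def)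
      show ?thesis
      proof (cases "i < k")
        case True
        then have "x (i + 1) \<le> x k" "x (i + 1) \<le> x (k + 1)" using i k' by (auto intro!: le)
        with im show ?thesis by (intro mult_pos_pos) auto
      next
        case False
        then have "x k \<le> x i" "x (k + 1) \<le> x i" using i k' that by (auto intro!: le)
        with im show ?thesis by (intro mult_neg_neg) auto
      qed
    qed
    have h: "poly h (x k) * poly h (x (k + 1)) = (\<Prod>i\<in>?T. (x k - m i) * (x (k + 1) - m i))"
      by (simp add: h_def poly_prod prod.distrib)
    show ?thesis
    proof (cases "k \<in> ?T")
      case True
      have "(\<Prod>i\<in>?T. (x k - m i) * (x (k + 1) - m i))
          = (x k - m k) * (x (k + 1) - m k) * (\<Prod>i\<in>?T - {k}. (x k - m i) * (x (k + 1) - m i))"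
        using True by (intro prod.remove) auto
      moreover have "0 < (\<Prod>i\<in>?T - {k}. (x k - m i) * (x (k + 1) - m i))"
        using pos by (intro prod_pos) auto
      moreover have "(x k - m k) * (x (k + 1) - m k) < 0"
        using mono[of k "k + 1"] k' by (intro mult_neg_pos) (auto simp: m_def)
      ultimately have "poly h (x k) * poly h (x (k + 1)) < 0"
        using h by (simp add: mult_neg_pos)
      moreover have "poly f (x k) * poly f (x (k + 1)) < 0" using True by simp
      ultimately have "0 < (poly f (x k) * poly f (x (k + 1))) * (poly h (x k) * poly h (x (k + 1)))"
        by (rule mult_neg_neg[rotated])
      then show ?thesis by (simp add: mult_ac)
    next
      case False
      then have "0 < poly h (x k) * poly h (x (k + 1))"
        unfolding h using pos by (intro prod_pos) auto
      moreover have "0 < poly f (x k) * poly f (x (k + 1))"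
        using False k fx[of k] fx[of "k + 1"] k'
        by (simp add: linorder_not_less) (metis less_eq_real_def mult_eq_0_iff)
      ultimately have "0 < (poly f (x k) * poly f (x (k + 1))) * (poly h (x k) * poly h (x (k + 1)))"
        by (rule mult_pos_pos[rotated])
      then show ?thesis by (simp add: mult_ac)
    qed
  qed
  have same: "0 < poly (f * h) (x 1) * poly (f * h) (x k)" if "1 \<le> k" "k \<le> n" for k
    using that
  proof (induction k rule: dec_induct)
    case base
    have "poly (f * h) (x 1) \<noteq> 0"
    proof (cases "n = 1")
      case True
      then have "?T = {}" by auto
      then have "h = 1" unfolding h_def by (simp only: prod.empty)
      then show ?thesis using fx[of 1] True by simp
    next
      case False
      then have "1 \<in> {1..n - 1}" using p(4) by simp
      from step[OF this] show ?thesis by force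
    qed
    then show ?case using not_real_square_gt_zero by blast
  next
    case (step k)
    have "0 < poly (f * h) (x k) * poly (f * h) (x (k + 1))"
      using step by (intro \<open>\<And>k. k \<in> {1..n - 1} \<Longrightarrow> _\<close>) auto
    moreover have "0 < poly (f * h) (x 1) * poly (f * h) (x k)" using step by simp
    ultimately show ?case by (auto simp: zero_less_mult_iff simp del: poly_mult)
  qed
  obtain wt where wt: "\<And>z. poly p z = 0 \<Longrightarrow> 0 < wt z"
    "\<And>g. degree g < 2 * degree p \<Longrightarrow> L g = (\<Sum>z | poly p z = 0. wt z * poly g z)"
    using gauss_quadrature[OF p(1,2)] by auto
  have "degree (f * h) < 2 * degree p"
    using degree_mult_le[of f h] deg less f(2) p(3) by linarith
  then have "L (f * h) = (\<Sum>z | poly p z = 0. wt z * poly (f * h) z)" by (rule wt(2))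
  then have "poly (f * h) (x 1) * L (f * h)
      = (\<Sum>z | poly p z = 0. wt z * (poly (f * h) (x 1) * poly (f * h) z))"
    by (simp add: sum_distrib_left mult_ac)
  also have "\<dots> > 0"
  proof (rule sum_pos)
    show "finite {z. poly p z = 0}" by (rule poly_roots_finite[OF p(1)])
    show "{z. poly p z = 0} \<noteq> {}" using x(2) p(4) by force
    fix z assume z: "z \<in> {z. poly p z = 0}"
    then obtain k where "1 \<le> k" "k \<le> n" "z = x k" using x(2) by force
    then show "0 < wt z * (poly (f * h) (x 1) * poly (f * h) z)"
      using same[of k] wt(1)[of z] z by (simp add: mult_pos_pos del: poly_mult)
  qed
  finally show False using L0 by simp
qed

end

section \<open>Integration against a Jacobi weight\<close>

definition jacobi_integral :: "real \<Rightarrow> real \<Rightarrow> real poly \<Rightarrow> real" where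
  "jacobi_integral \<alpha> \<beta> p =
     (LINT t:{-1<..<1}|lborel. poly p t * ((1 - t) powr \<alpha> * (1 + t) powr \<beta>))"

text \<open>The substitution \<open>t = 2 * u - 1\<close> turns the weight into the integrand of the Beta function.\<close>
lemma jacobi_weight_integrable:
  assumes "\<alpha> > -1" "\<beta> > -1"
  shows "set_integrable lborel {-1<..<1} (\<lambda>t::real. (1 - t) powr \<alpha> * (1 + t) powr \<beta>)"
proof -
  define g :: "real \<Rightarrow> real" where "g = (\<lambda>t. t powr (\<beta> + 1 - 1) * (1 - t) powr (\<alpha> + 1 - 1))"
  have "set_integrable lborel {0..1} g"
    unfolding g_def using assms by (intro integrable_Beta) auto
  then have "set_integrable lborel {0<..<1} g"
    by (rule set_integrable_subset) auto
  then have "integrable lborel (\<lambda>t. indicator {0<..<1} t *\<^sub>R g t)"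
    by (simp add: set_integrable_def)
  from lborel_integrable_real_affine[OF this, of "1/2" "1/2"]
  have "integrable lborel (\<lambda>t. (2 powr \<alpha> * 2 powr \<beta>) * (indicator {0<..<1} (1/2 + 1/2 * t) *\<^sub>R g (1/2 + 1/2 * t)))"
    by (intro integrable_mult_right) simp
  also have "(\<lambda>t. (2 powr \<alpha> * 2 powr \<beta>) * (indicator {0<..<1} (1/2 + 1/2 * t) *\<^sub>R g (1/2 + 1/2 * t)))
      = (\<lambda>t. indicator {-1<..<1} t *\<^sub>R ((1 - t) powr \<alpha> * (1 + t) powr \<beta>))"
  proof
    fix t :: real
    show "(2 powr \<alpha> * 2 powr \<beta>) * (indicator {0<..<1} (1/2 + 1/2 * t) *\<^sub>R g (1/2 + 1/2 * t))
        = indicator {-1<..<1} t *\<^sub>R ((1 - t) powr \<alpha> * (1 + t) powr \<beta>)"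
    proof (cases "t \<in> {-1<..<1}")
      case True
      have e: "1/2 + 1/2 * t = (1 + t) / 2" "1 - (1 + t) / 2 = (1 - t) / 2"
        by (simp_all add: field_simps)
      show ?thesis
        using True unfolding e g_def
        by (simp add: e powr_divide indicator_def)
    qed (auto simp: indicator_def)
  qed
  finally show ?thesis by (simp add: set_integrable_def)
qed

lemma jacobi_integrable:
  assumes "\<alpha> > -1" "\<beta> > -1"
  shows "set_integrable lborel {-1<..<1} (\<lambda>t::real. poly p t * ((1 - t) powr \<alpha> * (1 + t) powr \<beta>))"
proof -
  have "compact (poly p ` {-1..1::real})"
    by (intro compact_continuous_image continuous_intros) auto
  then obtain C where C: "\<And>t. t \<in> {-1..1} \<Longrightarrow> \<bar>poly p t\<bar> \<le> C"
    by (metis compact_imp_bounded bounded_real imageI)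
  have "set_integrable lborel {-1<..<1} (\<lambda>t. C * ((1 - t) powr \<alpha> * (1 + t) powr \<beta>))"
    using jacobi_weight_integrable[OF assms] by (rule set_integrable_mult_right)
  then show ?thesis
  proof (rule set_integrable_bound)
    show "set_borel_measurable lborel {-1<..<1} (\<lambda>t. poly p t * ((1 - t) powr \<alpha> * (1 + t) powr \<beta>))"
    proof -
      have "poly p \<in> borel_measurable lborel"
        by (auto intro!: borel_measurable_continuous_onI continuous_intros)
      moreover have "(\<lambda>t. indicator {-1<..<1} t *\<^sub>R ((1 - t) powr \<alpha> * (1 + t) powr \<beta>)) \<in> borel_measurable lborel"
        using jacobi_weight_integrable[OF assms] unfolding set_integrable_def
        by (rule borel_measurable_integrable)
      ultimately have "(\<lambda>t. poly p t * (indicator {-1<..<1} t *\<^sub>R ((1 - t) powr \<alpha> * (1 + t) powr \<beta>)))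
          \<in> borel_measurable lborel" by (rule borel_measurable_times)
      then show ?thesis unfolding set_borel_measurable_def by (simp add: mult.left_commute)
    qed
    show "AE t in lborel. t \<in> {-1<..<1} \<longrightarrow>
        norm (poly p t * ((1 - t) powr \<alpha> * (1 + t) powr \<beta>))
        \<le> norm (C * ((1 - t) powr \<alpha> * (1 + t) powr \<beta>))"
    proof (intro AE_I2 impI)
      fix t :: real assume "t \<in> {-1<..<1}"
      then have "\<bar>poly p t\<bar> \<le> \<bar>C\<bar>" using C[of t] by force
      then show "norm (poly p t * ((1 - t) powr \<alpha> * (1 + t) powr \<beta>))
          \<le> norm (C * ((1 - t) powr \<alpha> * (1 + t) powr \<beta>))"
        by (simp add: abs_mult mult_right_mono)
    qed
  qed
qed

lemma jacobi_integral_positive_functional: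
  assumes "\<alpha> > -1" "\<beta> > -1"
  shows "positive_functional (jacobi_integral \<alpha> \<beta>)"
proof
  fix p q :: "real poly" and c :: real
  show "jacobi_integral \<alpha> \<beta> (p + q) = jacobi_integral \<alpha> \<beta> p + jacobi_integral \<alpha> \<beta> q"
    using jacobi_integrable[OF assms]
    by (simp add: jacobi_integral_def distrib_right set_integral_add)
  show "jacobi_integral \<alpha> \<beta> (smult c p) = c * jacobi_integral \<alpha> \<beta> p"
    by (simp add: jacobi_integral_def mult.assoc)
  assume p: "p \<noteq> 0" and nonneg: "\<And>t. -1 < t \<Longrightarrow> t < 1 \<Longrightarrow> 0 \<le> poly p t"
  define f where "f t = indicator {-1<..<1} t *\<^sub>R (poly p t * ((1 - t) powr \<alpha> * (1 + t) powr \<beta>))" for t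
  have int: "integrable lborel f"
    using jacobi_integrable[OF assms, of p] by (simp add: f_def[abs_def] set_integrable_def)
  have f: "0 \<le> f t" for t using nonneg by (simp add: f_def indicator_def)
  have "integral\<^sup>L lborel f \<noteq> 0"
  proof
    assume "integral\<^sup>L lborel f = 0"
    then have "AE t in lborel. f t = 0"
      using integral_nonneg_eq_0_iff_AE[OF int] f by simp
    moreover have "AE t in lborel. t \<notin> {t. poly p t = 0}"
      using poly_roots_finite[OF p] by (intro AE_not_in finite_imp_null_set_lborel)
    ultimately have "AE t in lborel. t \<notin> {-1<..<1::real}"
      by eventually_elim (auto simp: f_def indicator_def)
    then have "emeasure lborel {-1<..<1::real} = 0"
      by (subst (asm) AE_iff_measurable[OF _ refl]) (auto simp: greaterThanLessThan_def greaterThan_def lessThan_def Collect_conj_eq)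
    then show False by simp
  qed
  moreover have "integral\<^sup>L lborel f \<ge> 0" using f by (intro integral_nonneg_AE) auto
  ultimately show "0 < jacobi_integral \<alpha> \<beta> p"
    by (simp add: jacobi_integral_def set_lebesgue_integral_def f_def[abs_def])
qed

lemma jacobi_sequence_iff:
  "jacobi_sequence \<alpha> \<beta> P \<longleftrightarrow>
     (\<forall>n. P n \<noteq> 0 \<and> degree (P n) = n) \<and>
     (\<forall>m n. m \<noteq> n \<longrightarrow> jacobi_integral \<alpha> \<beta> (P m * P n) = 0)"
  by (simp add: jacobi_sequence_def jacobi_integral_def)

text \<open>Raising both parameters by one multiplies the weight by \<open>1 - t\<^sup>2\<close>. Hence both polynomial sequences can be
studied with one and the same functional.\<close>
lemma jacobi_integral_Suc:
  "jacobi_integral (\<alpha> + 1) (\<beta> + 1) p = jacobi_integral \<alpha> \<beta> ([:1, 0, -1:] * p)"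
  unfolding jacobi_integral_def
proof (rule set_lebesgue_integral_cong)
  show "\<forall>t. t \<in> {-1<..<1} \<longrightarrow>
      poly p t * ((1 - t) powr (\<alpha> + 1) * (1 + t) powr (\<beta> + 1))
      = poly ([:1, 0, -1:] * p) t * ((1 - t) powr \<alpha> * (1 + t) powr \<beta>)"
    by (auto simp: powr_add algebra_simps)
qed simp

lemma symmetric_power_integral:
  "set_integrable lborel {-1<..<1} (\<lambda>t::real. t ^ k)"
  "(LINT t:{-1<..<1}|lborel. t ^ k) = (if even k then 2 / (real k + 1) else 0)"
proof -
  have int: "set_integrable lborel {-1..1} (\<lambda>t::real. t ^ k)"
    unfolding set_integrable_def by (rule borel_integrable_compact) (auto intro!: continuous_intros)
  then show "set_integrable lborel {-1<..<1} (\<lambda>t::real. t ^ k)"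
    by (rule set_integrable_subset) auto
  have "(LINT t:{-1<..<1}|lborel. t ^ k) = (LINT t:{-1..1}|lborel. t ^ k :: real)"
    unfolding set_lebesgue_integral_def
  proof (rule integral_cong_AE)
    have "AE t in lborel. t \<notin> {-1, 1 :: real}"
      by (intro AE_not_in finite_imp_null_set_lborel) auto
    then show "AE t in lborel. indicator {-1<..<1} t *\<^sub>R t ^ k = indicator {-1..1} t *\<^sub>R (t ^ k :: real)"
      by eventually_elim (auto simp: indicator_def)
  qed auto
  also have "\<dots> = (1 ^ Suc k - (-1) ^ Suc k) / real (Suc k)"
    using integral_power[of "-1" 1 k] by (simp add: set_lebesgue_integral_def mult.commute)
  finally show "(LINT t:{-1<..<1}|lborel. t ^ k) = (if even k then 2 / (real k + 1) else 0)"
    by (simp add: add.commute)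
qed

text \<open>For natural \<open>\<alpha>\<close> and \<open>\<beta>\<close> the weight is a polynomial and the functional can be evaluated coefficient by
coefficient. The exponent \<open>k\<close> is carried along so that the recursion over \<open>pCons\<close> is a rewrite rule.\<close>
definition symmetric_moment :: "nat \<Rightarrow> real poly \<Rightarrow> real" where
  "symmetric_moment k g = (LINT t:{-1<..<1}|lborel. t ^ k * poly g t)"

lemma symmetric_moment_0 [simp]: "symmetric_moment k 0 = 0"
  by (simp add: symmetric_moment_def)

lemma symmetric_moment_pCons:
  "symmetric_moment k (pCons c g)
     = c * (if even k then 2 / (real k + 1) else 0) + symmetric_moment (Suc k) g"
proof -
  have int: "set_integrable lborel {-1<..<1} (\<lambda>t::real. t ^ k * poly g t)" for k g
  proof -
    have "set_integrable lborel {-1..1} (\<lambda>t::real. t ^ k * poly g t)"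
      unfolding set_integrable_def by (rule borel_integrable_compact) (auto intro!: continuous_intros)
    then show ?thesis by (rule set_integrable_subset) auto
  qed
  have "symmetric_moment k (pCons c g)
      = (LINT t:{-1<..<1}|lborel. c * t ^ k + t ^ Suc k * poly g t)"
    by (simp add: symmetric_moment_def algebra_simps)
  also have "\<dots> = (LINT t:{-1<..<1}|lborel. c * t ^ k) + (LINT t:{-1<..<1}|lborel. t ^ Suc k * poly g t)"
    using symmetric_power_integral(1)[of k] int[of "Suc k" g]
    by (intro set_integral_add(2)) (auto intro!: set_integrable_mult_right)
  also have "\<dots> = c * (if even k then 2 / (real k + 1) else 0) + symmetric_moment (Suc k) g"
    unfolding symmetric_moment_def by (subst set_integral_mult_right) (simp only: symmetric_power_integral(2))
  finally show ?thesis .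
qed

lemma jacobi_integral_eq_moment:
  "jacobi_integral (real a) (real b) (p * monom 1 k)
     = symmetric_moment k (p * ([:1, -1:] ^ a * [:1, 1:] ^ b))"
  unfolding jacobi_integral_def symmetric_moment_def
  by (rule set_lebesgue_integral_cong)
     (auto simp: powr_realpow poly_monom algebra_simps)

lemma jacobi_sequence_annihilates:
  assumes "\<alpha> > -1" "\<beta> > -1" "jacobi_sequence \<alpha> \<beta> P"
  shows "positive_functional.annihilates (jacobi_integral \<alpha> \<beta>) (P n) n"
proof -
  interpret positive_functional "jacobi_integral \<alpha> \<beta>"
    using jacobi_integral_positive_functional[OF assms(1,2)] .
  show ?thesis
    using assms(3) by (intro annihilates_graded_basis[of n P]) (auto simp: jacobi_sequence_iff)
qed

lemma ex_jacobi_sequence: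
  assumes "\<alpha> > -1" "\<beta> > -1"
  shows "\<exists>P. jacobi_sequence \<alpha> \<beta> P"
proof -
  interpret positive_functional "jacobi_integral \<alpha> \<beta>"
    using jacobi_integral_positive_functional[OF assms] .
  obtain P where P: "\<And>n. P n \<noteq> 0 \<and> degree (P n) = n \<and> annihilates (P n) n"
    using ex_annihilates by metis
  have less: "jacobi_integral \<alpha> \<beta> (P n * P m) = 0" if "m < n" for m n
    using P that by (intro annihilatesD[of "P n" n]) auto
  have "jacobi_integral \<alpha> \<beta> (P m * P n) = 0" if "m \<noteq> n" for m n
    using less[of m n] less[of n m] that by (cases "m < n") (auto simp: mult.commute)
  then show ?thesis using P by (auto simp: jacobi_sequence_iff)
qed

lemma jacobi_zeros:
  assumes "\<alpha> > -1" "\<beta> > -1" "jacobi_sequence \<alpha> \<beta> P"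
  shows "{t. poly (P n) t = 0} \<subseteq> {-1<..<1}" "card {t. poly (P n) t = 0} = n"
    "poly (P n) t = 0 \<Longrightarrow> simple_zero (P n) t"
proof -
  interpret positive_functional "jacobi_integral \<alpha> \<beta>"
    using jacobi_integral_positive_functional[OF assms(1,2)] .
  have P: "P n \<noteq> 0" "degree (P n) = n" using assms(3) by (auto simp: jacobi_sequence_def)
  note z = zeros_of_annihilates[of "P n", unfolded P(2), OF P(1) jacobi_sequence_annihilates[OF assms]]
  show "{t. poly (P n) t = 0} \<subseteq> {-1<..<1}" "card {t. poly (P n) t = 0} = n"
    using z by auto
  show "simple_zero (P n) t" if "poly (P n) t = 0"
    using order_eq_1_if_card_roots_eq_degree[OF P(1) _ that] z(2) P by (simp add: simple_zero_def)
qed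

lemma jacobi_unique:
  assumes "\<alpha> > -1" "\<beta> > -1" "jacobi_sequence \<alpha> \<beta> P"
    and p: "p \<noteq> 0" "degree p = n" "positive_functional.annihilates (jacobi_integral \<alpha> \<beta>) p n"
  obtains c where "c \<noteq> 0" "P n = smult c p"
proof -
  interpret positive_functional "jacobi_integral \<alpha> \<beta>"
    using jacobi_integral_positive_functional[OF assms(1,2)] .
  have "P n \<noteq> 0" "degree (P n) = n" using assms(3) by (auto simp: jacobi_sequence_def)
  then show ?thesis
    using annihilates_unique[of "P n" p] jacobi_sequence_annihilates[OF assms(1-3), of n] p that by auto
qed

section \<open>Gaps that contain a zero\<close>

lemma jacobi_settingD:
  assumes "jacobi_setting n \<alpha> \<beta> P Q x"
  shows "n \<ge> 4" "\<alpha> > -1" "\<beta> > -1" "jacobi_sequence \<alpha> \<beta> P" "jacobi_sequence (\<alpha> + 1) (\<beta> + 1) Q"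
    "poly (P n) t = 0 \<Longrightarrow> poly (Q (n + 1)) t \<noteq> 0"
    "strict_mono_on {1..n} x" "x ` {1..n} = {t. poly (P n) t = 0}"
  using assms by (auto simp: jacobi_setting_def)

text \<open>The polynomial \<open>(1 - t\<^sup>2) * Q (n + 1)\<close> has degree \<open>n + 3\<close> and is orthogonal to all degrees up to \<open>n\<close> for
the weight of \<open>P\<close>. The factor \<open>1 - t\<^sup>2\<close> is positive at the zeros of \<open>P n\<close>, so it does not affect signs
there. The bound \<open>degree f + j \<le> 2 * n\<close> of \<open>sign_changes_at_zeros\<close> gives \<open>j = n - 3\<close>.\<close>
lemma jacobi_setting_sign_changes:
  assumes "jacobi_setting n \<alpha> \<beta> P Q x"
  shows "n - 3 \<le> card {k \<in> {1..n - 1}. poly (Q (n + 1)) (x k) * poly (Q (n + 1)) (x (k + 1)) < 0}"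
proof -
  note J = jacobi_settingD[OF assms]
  interpret positive_functional "jacobi_integral \<alpha> \<beta>"
    using jacobi_integral_positive_functional[OF J(2,3)] .
  interpret Q: positive_functional "jacobi_integral (\<alpha> + 1) (\<beta> + 1)"
    using J by (intro jacobi_integral_positive_functional) auto
  have P: "P n \<noteq> 0" "degree (P n) = n" "annihilates (P n) n"
    using J(4) jacobi_sequence_annihilates[OF J(2-4)] by (auto simp: jacobi_sequence_def)
  have Q: "Q (n + 1) \<noteq> 0" "degree (Q (n + 1)) = n + 1" "Q.annihilates (Q (n + 1)) (n + 1)"
    using J(2,3,5) jacobi_sequence_annihilates[of "\<alpha> + 1" "\<beta> + 1" Q "n + 1"]
    by (auto simp: jacobi_sequence_def)
  define f where "f = [:1, 0, -1:] * Q (n + 1)"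
  have f_eval: "poly f t = (1 - t\<^sup>2) * poly (Q (n + 1)) t" for t
    by (simp add: f_def power2_eq_square algebra_simps)
  have zero_range: "0 < 1 - t\<^sup>2" if "poly (P n) t = 0" for t
    using jacobi_zeros(1)[OF J(2-4), of n] that by (auto simp: abs_square_less_1 abs_less_iff)
  have "jacobi_integral \<alpha> \<beta> (f * r) = jacobi_integral (\<alpha> + 1) (\<beta> + 1) (Q (n + 1) * r)" for r
    by (simp only: f_def jacobi_integral_Suc mult.assoc)
  then have "annihilates f (n + 1)"
    using Q(3) by (simp add: annihilates_def Q.annihilates_def)
  then have "annihilates f (n - 3)" by (auto simp: annihilates_def)
  moreover have "degree f = n + 3"
    unfolding f_def using Q by (subst degree_mult_eq) auto
  moreover have "poly f t \<noteq> 0" if "poly (P n) t = 0" for t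
    using J(6)[OF that] zero_range[OF that] by (simp add: f_eval)
  ultimately have "n - 3 \<le> card {k \<in> {1..n - 1}. poly f (x k) * poly f (x (k + 1)) < 0}"
    using P J(1,7,8) by (intro sign_changes_at_zeros[of "P n"]) auto
  also have "{k \<in> {1..n - 1}. poly f (x k) * poly f (x (k + 1)) < 0}
      = {k \<in> {1..n - 1}. poly (Q (n + 1)) (x k) * poly (Q (n + 1)) (x (k + 1)) < 0}"
  proof (intro Collect_cong conj_cong refl)
    fix k assume "k \<in> {1..n - 1}"
    then have "k \<in> {1..n}" "k + 1 \<in> {1..n}" by auto
    then have "poly (P n) (x k) = 0" "poly (P n) (x (k + 1)) = 0" using J(8) by auto
    then have "0 < (1 - (x k)\<^sup>2) * (1 - (x (k + 1))\<^sup>2)"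
      using zero_range by (intro mult_pos_pos)
    moreover have "poly f (x k) * poly f (x (k + 1)) = ((1 - (x k)\<^sup>2) * (1 - (x (k + 1))\<^sup>2))
        * (poly (Q (n + 1)) (x k) * poly (Q (n + 1)) (x (k + 1)))"
      unfolding f_eval by (simp only: mult_ac)
    ultimately show "poly f (x k) * poly f (x (k + 1)) < 0
        \<longleftrightarrow> poly (Q (n + 1)) (x k) * poly (Q (n + 1)) (x (k + 1)) < 0"
      using mult_less_cancel_left_pos by (metis mult_zero_right)
  qed
  finally show ?thesis .
qed

lemma jacobi_setting_gaps_with_zero:
  assumes "jacobi_setting n \<alpha> \<beta> P Q x"
  shows "n - 3 \<le> card {k \<in> {1..n - 1}. \<exists>t \<in> {x k<..<x (k + 1)}. simple_zero (Q (n + 1)) t}"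
proof -
  note J = jacobi_settingD[OF assms]
  have "\<exists>t \<in> {x k<..<x (k + 1)}. simple_zero (Q (n + 1)) t"
    if k: "k \<in> {1..n - 1}" and neg: "poly (Q (n + 1)) (x k) * poly (Q (n + 1)) (x (k + 1)) < 0" for k
  proof -
    have "x k < x (k + 1)" using k J(1) by (intro strict_mono_onD[OF J(7)]) auto
    from poly_IVT[OF this neg] obtain t where "x k < t" "t < x (k + 1)" "poly (Q (n + 1)) t = 0"
      by auto
    then show ?thesis
      using jacobi_zeros(3)[OF _ _ J(5), of "n + 1" t] J(2,3) by auto
  qed
  then have "card {k \<in> {1..n - 1}. poly (Q (n + 1)) (x k) * poly (Q (n + 1)) (x (k + 1)) < 0}
      \<le> card {k \<in> {1..n - 1}. \<exists>t \<in> {x k<..<x (k + 1)}. simple_zero (Q (n + 1)) t}"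
    by (intro card_mono) auto
  then show ?thesis using jacobi_setting_sign_changes[OF assms] by linarith
qed

lemma simple_zero_imp_zero: "simple_zero p t \<Longrightarrow> poly p t = 0"
  using order_root[of p t] by (auto simp: simple_zero_def)

text \<open>The chosen zeros are distinct because the gaps are disjoint.\<close>
lemma card_remaining_zeros:
  assumes "jacobi_setting n \<alpha> \<beta> P Q x" "remaining_zeros n (Q (n + 1)) x R"
  shows "card R = 4"
proof -
  note J = jacobi_settingD[OF assms(1)]
  obtain K y where K: "K \<subseteq> {1..n - 1}" "card K = n - 3"
    and y: "\<And>k. k \<in> K \<Longrightarrow> x k < y k \<and> y k < x (k + 1) \<and> simple_zero (Q (n + 1)) (y k)"
    and R: "R = {t. poly (Q (n + 1)) t = 0} - y ` K"
    using assms(2) by (auto simp: remaining_zeros_def)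
  have "y k < y l" if "k \<in> K" "l \<in> K" "k < l" for k l
  proof -
    have "k + 1 \<in> {1..n}" "l \<in> {1..n}" using that K by fastforce+
    then have "x (k + 1) \<le> x l"
      using J(7) that by (cases "k + 1 = l") (auto simp: strict_mono_on_def intro: less_imp_le)
    then show ?thesis using y[OF that(1)] y[OF that(2)] by linarith
  qed
  then have "inj_on y K" by (metis inj_onI less_irrefl linorder_neqE_nat)
  then have "card (y ` K) = n - 3" using K by (simp add: card_image)
  moreover have "y ` K \<subseteq> {t. poly (Q (n + 1)) t = 0}" using y simple_zero_imp_zero by auto
  moreover have "card {t. poly (Q (n + 1)) t = 0} = n + 1"
    using jacobi_zeros(2)[OF _ _ J(5), of "n + 1"] J(2,3) by simp
  moreover have "finite K" using K(1) by (rule finite_subset) simp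
  ultimately show ?thesis using J(1) by (simp add: R card_Diff_subset)
qed

section \<open>The zeros beyond the last node\<close>

definition is_jacobi_poly :: "real \<Rightarrow> real \<Rightarrow> nat \<Rightarrow> real poly \<Rightarrow> bool" where
  "is_jacobi_poly \<alpha> \<beta> n p \<longleftrightarrow>
     p \<noteq> 0 \<and> degree p = n \<and> (\<forall>r. degree r < n \<longrightarrow> jacobi_integral \<alpha> \<beta> (p * r) = 0)"

lemma jacobi_sequence_zeros_eq:
  assumes "\<alpha> > -1" "\<beta> > -1" "jacobi_sequence \<alpha> \<beta> P" "is_jacobi_poly \<alpha> \<beta> n p"
  shows "poly (P n) t = 0 \<longleftrightarrow> poly p t = 0"
proof -
  interpret positive_functional "jacobi_integral \<alpha> \<beta>"
    using jacobi_integral_positive_functional[OF assms(1,2)] .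
  obtain c where "c \<noteq> 0" "P n = smult c p"
    using jacobi_unique[OF assms(1-3), of p n] assms(4)
    by (auto simp: is_jacobi_poly_def annihilates_def)
  then show ?thesis by simp
qed

text \<open>The number of these zeros is the last entry of a location. Unlike the location it refers only to
the zero sets of two polynomials, so any nonzero multiples of Jacobi polynomials can stand for them.\<close>
definition zeros_beyond :: "real poly \<Rightarrow> real poly \<Rightarrow> real set" where
  "zeros_beyond p q = {t. poly q t = 0 \<and> (\<forall>z. poly p z = 0 \<longrightarrow> z < t)}"

text \<open>The zeros that are taken out lie between nodes, so to the right of the last node all zeros of
\<open>Q (n + 1)\<close> remain, whatever the choices were.\<close>
lemma locations_right_component:
  assumes p: "is_jacobi_poly \<alpha> \<beta> n p" and q: "is_jacobi_poly (\<alpha> + 1) (\<beta> + 1) (n + 1) q"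
    and "L \<in> locations n \<alpha> \<beta>"
  shows "snd (snd L) = card (zeros_beyond p q)"
proof -
  obtain P Q x R where J: "jacobi_setting n \<alpha> \<beta> P Q x"
    and R: "remaining_zeros n (Q (n + 1)) x R" and L: "L = location n x R"
    using assms(3) by (auto simp: locations_def)
  note J' = jacobi_settingD[OF J]
  have \<alpha>\<beta>: "\<alpha> + 1 > -1" "\<beta> + 1 > -1" using J' by auto
  have P: "poly (P n) t = 0 \<longleftrightarrow> poly p t = 0" for t
    by (rule jacobi_sequence_zeros_eq[OF J'(2-4) p])
  have Q: "poly (Q (n + 1)) t = 0 \<longleftrightarrow> poly q t = 0" for t
    by (rule jacobi_sequence_zeros_eq[OF \<alpha>\<beta> J'(5) q])
  obtain K y where K: "K \<subseteq> {1..n - 1}"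
    and y: "\<And>k. k \<in> K \<Longrightarrow> y k < x (k + 1)"
    and R: "R = {t. poly (Q (n + 1)) t = 0} - y ` K"
    using R by (auto simp: remaining_zeros_def)
  have le: "x k \<le> x n" if "k \<in> {1..n}" for k
    using J'(7) that by (cases "k = n") (auto simp: strict_mono_on_def intro: less_imp_le)
  have yn: "y k < x n" if "k \<in> K" for k
  proof -
    have "k + 1 \<in> {1..n}" using that K by fastforce
    then show ?thesis using y[OF that] le[of "k + 1"] by linarith
  qed
  have beyond: "x n < t \<longleftrightarrow> (\<forall>z. poly p z = 0 \<longrightarrow> z < t)" for t
  proof
    assume "x n < t"
    show "\<forall>z. poly p z = 0 \<longrightarrow> z < t"
    proof (intro allI impI)
      fix z assume "poly p z = 0"
      then have "z \<in> x ` {1..n}" using J'(8) P by simp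
      then obtain k where "k \<in> {1..n}" "z = x k" by auto
      then show "z < t" using le[of k] \<open>x n < t\<close> by simp
    qed
  next
    assume "\<forall>z. poly p z = 0 \<longrightarrow> z < t"
    moreover have "x n \<in> x ` {1..n}" using J'(1) by (intro imageI) simp
    then have "poly p (x n) = 0" using J'(8) P by simp
    ultimately show "x n < t" by blast
  qed
  have lt1: "t < 1" if "poly q t = 0" for t
    using jacobi_zeros(1)[OF \<alpha>\<beta> J'(5), of "n + 1"] Q that by force
  have "R \<inter> {x n<..<1} = zeros_beyond p q"
  proof (intro set_eqI iffI)
    fix t assume "t \<in> R \<inter> {x n<..<1}"
    then show "t \<in> zeros_beyond p q" using Q[of t] by (simp add: R zeros_beyond_def flip: beyond)
  next
    fix t assume "t \<in> zeros_beyond p q"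
    then have "poly q t = 0" and "x n < t" by (simp_all add: zeros_beyond_def flip: beyond)
    moreover from \<open>x n < t\<close> have "t \<notin> y ` K" using yn less_asym by blast
    ultimately show "t \<in> R \<inter> {x n<..<1}" using lt1[of t] Q[of t] by (simp add: R)
  qed
  then show ?thesis by (simp add: L location_def)
qed

lemma ex_strict_mono_enumeration:
  fixes Z :: "real set"
  assumes "finite Z" "card Z = n"
  obtains x where "strict_mono_on {1..n} x" "x ` {1..n} = Z"
proof -
  define xs where "xs = sorted_list_of_set Z"
  have xs: "sorted_wrt (<) xs" "set xs = Z" "length xs = n"
    using assms by (auto simp: xs_def)
  define x where "x k = xs ! (k - 1)" for k
  have "strict_mono_on {1..n} x"
    unfolding strict_mono_on_def x_def
    using xs(3) sorted_wrt_nth_less[OF xs(1)] by auto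
  moreover have "x ` {1..n} = Z"
  proof -
    have "x ` {1..n} = (!) xs ` ((\<lambda>k. k - 1) ` {1..n})" by (simp add: image_image x_def)
    also have "(\<lambda>k. k - 1) ` {1..n} = {..<n}"
    proof -
      have "k \<in> (\<lambda>k. k - 1) ` {1..n}" if "k < n" for k
        using that by (intro image_eqI[of _ _ "k + 1"]) auto
      then show ?thesis by auto
    qed
    also have "(!) xs ` {..<n} = Z" using xs by (auto simp: set_conv_nth)
    finally show ?thesis .
  qed
  ultimately show ?thesis using that by blast
qed
text \<open>The bound on the number of gaps with a zero is what provides the zeros that are taken out.\<close>
lemma locations_nonempty:
  assumes "n \<ge> 4" "\<alpha> > -1" "\<beta> > -1"
    and p: "is_jacobi_poly \<alpha> \<beta> n p" and q: "is_jacobi_poly (\<alpha> + 1) (\<beta> + 1) (n + 1) q"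
    and no_common: "\<And>t. poly p t = 0 \<Longrightarrow> poly q t \<noteq> 0"
  shows "locations n \<alpha> \<beta> \<noteq> {}"
proof -
  have \<alpha>\<beta>: "\<alpha> + 1 > -1" "\<beta> + 1 > -1" using assms by auto
  obtain P where P: "jacobi_sequence \<alpha> \<beta> P" using ex_jacobi_sequence[OF assms(2,3)] by blast
  obtain Q where Q: "jacobi_sequence (\<alpha> + 1) (\<beta> + 1) Q" using ex_jacobi_sequence[OF \<alpha>\<beta>] by blast
  have "P n \<noteq> 0" using P by (simp add: jacobi_sequence_def)
  obtain x where x: "strict_mono_on {1..n} x" "x ` {1..n} = {t. poly (P n) t = 0}"
    using ex_strict_mono_enumeration[OF poly_roots_finite[OF \<open>P n \<noteq> 0\<close>]]
      jacobi_zeros(2)[OF assms(2,3) P] by metis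
  have "x k \<in> {-1<..<1}" if "k \<in> {1..n}" for k
    using x(2) that jacobi_zeros(1)[OF assms(2,3) P, of n] by blast
  then have "-1 < x 1" "x n < 1" using assms(1) by auto
  then have J: "jacobi_setting n \<alpha> \<beta> P Q x"
    using assms P Q x jacobi_sequence_zeros_eq[OF assms(2,3) P p]
      jacobi_sequence_zeros_eq[OF \<alpha>\<beta> Q q]
    by (auto simp: jacobi_setting_def)
  obtain K where K: "K \<subseteq> {k \<in> {1..n - 1}. \<exists>t \<in> {x k<..<x (k + 1)}. simple_zero (Q (n + 1)) t}"
      "card K = n - 3"
    using jacobi_setting_gaps_with_zero[OF J] by (meson obtain_subset_with_card_n)
  from K(1) have "\<forall>k\<in>K. \<exists>t. t \<in> {x k<..<x (k + 1)} \<and> simple_zero (Q (n + 1)) t" by blast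
  then obtain y where y: "\<forall>k\<in>K. y k \<in> {x k<..<x (k + 1)} \<and> simple_zero (Q (n + 1)) (y k)"
    by (rule bchoice[THEN exE])
  moreover have "K \<subseteq> {1..n - 1}" using K(1) by blast
  ultimately have "remaining_zeros n (Q (n + 1)) x ({t. poly (Q (n + 1)) t = 0} - y ` K)"
    using K(2) unfolding remaining_zeros_def by (intro exI[of _ K] exI[of _ y]) simp
  with J show ?thesis unfolding locations_def by blast
qed

lemma different_locationsI:
  assumes "n \<ge> 4" "\<alpha> > -1" "\<beta> > -1"
    and "is_jacobi_poly \<alpha> \<beta> n p" "is_jacobi_poly (\<alpha> + 1) (\<beta> + 1) (n + 1) q"
    and "\<And>t. poly p t = 0 \<Longrightarrow> poly q t \<noteq> 0"
    and "n' \<ge> 4" "\<alpha>' > -1" "\<beta>' > -1"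
    and "is_jacobi_poly \<alpha>' \<beta>' n' p'" "is_jacobi_poly (\<alpha>' + 1) (\<beta>' + 1) (n' + 1) q'"
    and "\<And>t. poly p' t = 0 \<Longrightarrow> poly q' t \<noteq> 0"
    and ne: "zeros_beyond p q \<noteq> {}" and e: "zeros_beyond p' q' = {}"
  shows "different_locations (n, \<alpha>, \<beta>) (n', \<alpha>', \<beta>')"
proof -
  have "q \<noteq> 0" using assms(5) by (simp add: is_jacobi_poly_def)
  then have "finite (zeros_beyond p q)"
    using finite_subset[OF _ poly_roots_finite[of q]] by (auto simp: zeros_beyond_def)
  with ne have "card (zeros_beyond p q) \<noteq> 0" by simp
  moreover have "card (zeros_beyond p' q') = 0" using e by simp
  ultimately have "locations n \<alpha> \<beta> \<inter> locations n' \<alpha>' \<beta>' = {}"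
    using locations_right_component[OF assms(4,5)] locations_right_component[OF assms(10,11)]
    by fastforce
  then show ?thesis
    using locations_nonempty[OF assms(1-6)] locations_nonempty[OF assms(7-12)]
    by (simp add: different_locations_def)
qed

text \<open>A certificate by Taylor coefficients at \<open>c\<close>. It always exists for a polynomial whose zeros are
all real and less than \<open>c\<close> and whose leading coefficient is positive.\<close>
lemma poly_pos_beyond:
  fixes p :: "real poly"
  assumes "\<forall>a\<in>set (coeffs (pcompose p [:c, 1:])). 0 < a" "p \<noteq> 0" "c \<le> t"
  shows "0 < poly p t"
proof -
  have *: "0 < poly r u" if "\<forall>a\<in>set (coeffs r). 0 < a" "r \<noteq> 0" "0 \<le> u" for r :: "real poly" and u
    using that
  proof (induction r)
    case (pCons a r)
    then show ?case by (cases "r = 0") (auto simp: add_pos_nonneg)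
  qed simp
  have "poly p t = poly (pcompose p [:c, 1:]) (t - c)" by (simp add: poly_pcompose)
  moreover have "pcompose p [:c, 1:] \<noteq> 0" using assms(2) by (simp add: pcompose_eq_0_iff)
  ultimately show ?thesis using *[of "pcompose p [:c, 1:]" "t - c"] assms by simp
qed

lemma no_common_zero_if_bezout:
  fixes p q u v :: "real poly"
  assumes "u * p + v * q = [:c:]" "c \<noteq> 0" "poly p t = 0"
  shows "poly q t \<noteq> 0"
proof
  assume "poly q t = 0"
  with assms(3) have "poly (u * p + v * q) t = 0" by simp
  with assms(1,2) show False by simp
qed

lemma is_jacobi_poly_moments:
  assumes "\<alpha> = real a" "\<beta> = real b" "p \<noteq> 0" "degree p = n"
    and "\<forall>k\<in>set [0..<n]. symmetric_moment k (p * ([:1, -1:] ^ a * [:1, 1:] ^ b)) = 0"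
  shows "is_jacobi_poly \<alpha> \<beta> n p"
proof -
  interpret positive_functional "jacobi_integral (real a) (real b)"
    by (rule jacobi_integral_positive_functional) auto
  have "annihilates p n"
    using assms(5)
    by (intro annihilates_graded_basis[of n "monom 1"])
       (auto simp: jacobi_integral_eq_moment degree_monom_eq)
  then show ?thesis using assms by (simp add: is_jacobi_poly_def annihilates_def)
qed

lemma zeros_beyond_nonempty:
  assumes "\<And>t. c \<le> t \<Longrightarrow> 0 < poly p t" "poly q c < 0" "0 < poly q d" "c < d"
  shows "zeros_beyond p q \<noteq> {}"
proof -
  obtain t where "c < t" "poly q t = 0" using poly_IVT_pos[OF assms(4,2,3)] by auto
  moreover have "z < t" if "poly p z = 0" for z
    using assms(1)[of z] that \<open>c < t\<close> by (cases "c \<le> z") auto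
  ultimately show ?thesis by (auto simp: zeros_beyond_def)
qed

lemma zeros_beyond_empty:
  assumes "\<And>t. c \<le> t \<Longrightarrow> 0 < poly q t" "poly p c < 0" "0 < poly p d" "c < d"
  shows "zeros_beyond p q = {}"
proof -
  obtain z where z: "c < z" "poly p z = 0" using poly_IVT_pos[OF assms(4,2,3)] by auto
  have "\<not> z < t" if "poly q t = 0" for t
    using assms(1)[of t] that z by auto
  with z show ?thesis by (auto simp: zeros_beyond_def)
qed

section \<open>Four explicit pairs of Jacobi polynomials\<close>

text \<open>The polynomials below are Jacobi polynomials scaled to coprime integer coefficients. The
cofactors in the proofs of the \<open>no_common_zero\<close> lemmas come from the extended Euclidean
algorithm. The cut in each \<open>zeros_beyond\<close> lemma is a fraction that separates the largest zeros of the
two polynomials. These lie near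
\<open>0.7651 < 0.7695\<close> for \<open>(n, \<alpha>, \<beta>) = (4, 1, 1)\<close>, where the zero of \<open>Q (n + 1)\<close> is the larger one, and
near \<open>0.8302 > 0.8198\<close> for \<open>(5, 1, 1)\<close>, \<open>0.8858 > 0.8508\<close> for \<open>(4, 0, 1)\<close> and
\<open>0.7973 > 0.7928\<close> for \<open>(4, 1, 2)\<close>, where the zero of \<open>P n\<close> is the larger one.\<close>
lemma jacobi_poly_4_1_1: "is_jacobi_poly 1 1 4 [:1, 0, -14, 0, 21:]"
  by (rule is_jacobi_poly_moments[where a = 1 and b = 1])
    (simp_all add: upt_rec power2_eq_square power3_eq_cube symmetric_moment_pCons)

lemma jacobi_poly_5_2_2: "is_jacobi_poly 2 2 5 [:0, 15, 0, -110, 0, 143:]"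
  by (rule is_jacobi_poly_moments[where a = 2 and b = 2])
    (simp_all add: upt_rec power2_eq_square power3_eq_cube symmetric_moment_pCons)

lemma no_common_zero_4_1_1:
  assumes "poly [:1, 0, -14, 0, 21:] t = 0"
  shows "poly [:0, 15, 0, -110, 0, 143:] t \<noteq> (0::real)"
proof (rule no_common_zero_if_bezout[OF _ _ assms])
  show "[:304, 0, -8239, 0, 25025:] * [:1, 0, -14, 0, 21:]
      + [:0, 833, 0, -3675:] * [:0, 15, 0, -110, 0, 143:] = ([:304:] :: real poly)"
    by simp
qed simp

lemma zeros_beyond_4_1_1:
  "zeros_beyond [:1, 0, -14, 0, 21:] [:0, 15, 0, -110, 0, 143:] \<noteq> {}"
proof (rule zeros_beyond_nonempty[of "10 / 13" _ _ 1])
  fix t :: real assume "10 / 13 \<le> t"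
  then show "0 < poly [:1, 0, -14, 0, 21:] t"
    by (intro poly_pos_beyond[of _ "10 / 13"]) (auto simp: pcompose_pCons)
qed simp_all

lemma jacobi_poly_5_1_1: "is_jacobi_poly 1 1 5 [:0, 5, 0, -30, 0, 33:]"
  by (rule is_jacobi_poly_moments[where a = 1 and b = 1])
    (simp_all add: upt_rec power2_eq_square power3_eq_cube symmetric_moment_pCons)

lemma jacobi_poly_6_2_2: "is_jacobi_poly 2 2 6 [:-1, 0, 33, 0, -143, 0, 143:]"
  by (rule is_jacobi_poly_moments[where a = 2 and b = 2])
    (simp_all add: upt_rec power2_eq_square power3_eq_cube symmetric_moment_pCons)

lemma no_common_zero_5_1_1:
  assumes "poly [:0, 5, 0, -30, 0, 33:] t = 0"
  shows "poly [:-1, 0, 33, 0, -143, 0, 143:] t \<noteq> (0::real)"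
proof (rule no_common_zero_if_bezout[OF _ _ assms])
  show "[:0, 1023, 0, -6721, 0, 6292:] * [:0, 5, 0, -30, 0, 33:]
      + [:-112, 0, 1419, 0, -1452:] * [:-1, 0, 33, 0, -143, 0, 143:] = ([:112:] :: real poly)"
    by simp
qed simp

lemma zeros_beyond_5_1_1:
  "zeros_beyond [:0, 5, 0, -30, 0, 33:] [:-1, 0, 33, 0, -143, 0, 143:] = {}"
proof (rule zeros_beyond_empty[of "14 / 17" _ _ 1])
  fix t :: real assume "14 / 17 \<le> t"
  then show "0 < poly [:-1, 0, 33, 0, -143, 0, 143:] t"
    by (intro poly_pos_beyond[of _ "14 / 17"]) (auto simp: pcompose_pCons)
qed simp_all

lemma jacobi_poly_4_0_1: "is_jacobi_poly 0 1 4 [:3, 12, -42, -28, 63:]"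
  by (rule is_jacobi_poly_moments[where a = 0 and b = 1])
    (simp_all add: upt_rec power2_eq_square power3_eq_cube symmetric_moment_pCons)

lemma jacobi_poly_5_1_2: "is_jacobi_poly 1 2 5 [:-5, 45, 90, -330, -165, 429:]"
  by (rule is_jacobi_poly_moments[where a = 1 and b = 2])
    (simp_all add: upt_rec power2_eq_square power3_eq_cube symmetric_moment_pCons)

lemma no_common_zero_4_0_1:
  assumes "poly [:3, 12, -42, -28, 63:] t = 0"
  shows "poly [:-5, 45, 90, -330, -165, 429:] t \<noteq> (0::real)"
proof (rule no_common_zero_if_bezout[OF _ _ assms])
  show "[:293861499, 547692924, -5014405770, -3266946540, 7824837735:] * [:3, 12, -42, -28, 63:]
      + [:-46402243, 616263165, 548511075, -1149102045:] * [:-5, 45, 90, -330, -165, 429:] = ([:1113595712:] :: real poly)"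
    by simp
qed simp

lemma zeros_beyond_4_0_1:
  "zeros_beyond [:3, 12, -42, -28, 63:] [:-5, 45, 90, -330, -165, 429:] = {}"
proof (rule zeros_beyond_empty[of "7 / 8" _ _ 1])
  fix t :: real assume "7 / 8 \<le> t"
  then show "0 < poly [:-5, 45, 90, -330, -165, 429:] t"
    by (intro poly_pos_beyond[of _ "7 / 8"]) (auto simp: pcompose_pCons)
qed simp_all

lemma jacobi_poly_4_1_2: "is_jacobi_poly 1 2 4 [:1, 4, -18, -12, 33:]"
  by (rule is_jacobi_poly_moments[where a = 1 and b = 2])
    (simp_all add: upt_rec power2_eq_square power3_eq_cube symmetric_moment_pCons)

lemma jacobi_poly_5_2_3: "is_jacobi_poly 2 3 5 [:-3, 33, 66, -286, -143, 429:]"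
  by (rule is_jacobi_poly_moments[where a = 2 and b = 3])
    (simp_all add: upt_rec power2_eq_square power3_eq_cube symmetric_moment_pCons)

lemma no_common_zero_4_1_2:
  assumes "poly [:1, 4, -18, -12, 33:] t = 0"
  shows "poly [:-3, 33, 66, -286, -143, 429:] t \<noteq> (0::real)"
proof (rule no_common_zero_if_bezout[OF _ _ assms])
  show "[:140063, 990748, -1503502, -5140564, -901329:] * [:1, 4, -18, -12, 33:]
      + [:-36875, 111375, 393327, 69333:] * [:-3, 33, 66, -286, -143, 429:] = ([:250688:] :: real poly)"
    by simp
qed simp

lemma zeros_beyond_4_1_2:
  "zeros_beyond [:1, 4, -18, -12, 33:] [:-3, 33, 66, -286, -143, 429:] = {}"
proof (rule zeros_beyond_empty[of "27 / 34" _ _ 1])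
  fix t :: real assume "27 / 34 \<le> t"
  then show "0 < poly [:-3, 33, 66, -286, -143, 429:] t"
    by (intro poly_pos_beyond[of _ "27 / 34"]) (auto simp: pcompose_pCons)
qed simp_all

section \<open>Zeros in the gaps and the location of the remaining zeros\<close>

theorem theorem2:
  shows "(\<forall>n \<alpha> \<beta> P Q x. jacobi_setting n \<alpha> \<beta> P Q x \<longrightarrow>
            n - 3 \<le> card {k \<in> {1..n - 1}. \<exists>t \<in> {x k<..<x (k + 1)}. simple_zero (Q (n + 1)) t} \<and>
            (\<forall>R. remaining_zeros n (Q (n + 1)) x R \<longrightarrow> card R = 4)) \<and>
         (\<nexists>L. \<forall>n \<alpha> \<beta>. locations n \<alpha> \<beta> \<noteq> {} \<longrightarrow> L \<in> locations n \<alpha> \<beta>) \<and>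
         (\<exists>n n' \<alpha> \<beta>. different_locations (n, \<alpha>, \<beta>) (n', \<alpha>, \<beta>)) \<and>
         (\<exists>n \<alpha> \<alpha>' \<beta>. different_locations (n, \<alpha>, \<beta>) (n, \<alpha>', \<beta>)) \<and>
         (\<exists>n \<alpha> \<beta> \<beta>'. different_locations (n, \<alpha>, \<beta>) (n, \<alpha>, \<beta>'))"
proof -
  \<comment> \<open>One base case is compared with three others that differ from it in a single parameter.\<close>
  have n: "different_locations (4, 1, 1) (5, 1, 1)"
    by (rule different_locationsI[OF _ _ _ _ _ no_common_zero_4_1_1
          _ _ _ _ _ no_common_zero_5_1_1 zeros_beyond_4_1_1 zeros_beyond_5_1_1])
      (simp_all add: jacobi_poly_4_1_1 jacobi_poly_5_2_2 jacobi_poly_5_1_1 jacobi_poly_6_2_2)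
  have a: "different_locations (4, 1, 1) (4, 0, 1)"
    by (rule different_locationsI[OF _ _ _ _ _ no_common_zero_4_1_1
          _ _ _ _ _ no_common_zero_4_0_1 zeros_beyond_4_1_1 zeros_beyond_4_0_1])
      (simp_all add: jacobi_poly_4_1_1 jacobi_poly_5_2_2 jacobi_poly_4_0_1 jacobi_poly_5_1_2)
  have b: "different_locations (4, 1, 1) (4, 1, 2)"
    by (rule different_locationsI[OF _ _ _ _ _ no_common_zero_4_1_1
          _ _ _ _ _ no_common_zero_4_1_2 zeros_beyond_4_1_1 zeros_beyond_4_1_2])
      (simp_all add: jacobi_poly_4_1_1 jacobi_poly_5_2_2 jacobi_poly_4_1_2 jacobi_poly_5_2_3)
  have "\<nexists>L. \<forall>n \<alpha> \<beta>. locations n \<alpha> \<beta> \<noteq> {} \<longrightarrow> L \<in> locations n \<alpha> \<beta>"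
    using n unfolding different_locations_def by blast
  with n a b show ?thesis
    using jacobi_setting_gaps_with_zero card_remaining_zeros by blast
qed

end
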